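(* For each $n\ge2$ let $(w_1,\dots,w_n)=(w_{n1},\dots,w_{nn})$ be a weight vector (a probability vector with positive entries), put $w_r^+:=\sum_{j=1}^r w_j$, and let $T_n$ be a random variable with distribution $\bigoplus_{r=2}^n\mathrm{Geom}(w_r^+)$. Say that "$k_n$ steps are necessary and sufficient" if $T_n/k_n\to1$ in probability as $n\to\infty$. Then: (a) (Uniform weights.) If $w_i=1/n$ for all $i$, then $n\ln n$ steps are necessary and sufficient. (b) (Zipf's law.) If $w_i=(H_n i)^{-1}$ with $H_n:=\sum_{k=1}^n k^{-1}$, then $n$ steps are necessary and sufficient. (c) (Generalized Zipf's law.) Let $w_i=\left(i^{\alpha}H_n^{(\alpha)}\right)^{-1}$ with $H_n^{(\alpha)}:=\sum_{i=1}^n i^{-\alpha}$ and $\alpha$ fixed. (i) If $0<\alpha<1$, then $n/\alpha$ steps are necessary and sufficient. (ii) If $\alpha>1$, then $n$ steps are necessary and sufficient. (d) (Power law.) Fix $s>0$. If $w_i=(n-i+1)^s/f(n,s)$ with $f(n,s):=\sum_{j=1}^n j^s$, then $\frac{n\ln n}{s+1}$ steps are necessary and sufficient. (e) (Geometric weights.) Fix $0<\theta<1$. If $w_i=(1-\theta)\theta^{i-1}$ for $i=1,\dots,n-1$ and $w_n=\theta^{n-1}$, then $n$ steps are necessary and sufficient.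
   Context: $\mathrm{Geom}(p)$ is the geometric distribution on $\{1,2,\dots\}$ with success probability $p$, and $\bigoplus$ denotes convolution (the law of a sum of independent random variables). The law of $T_n$ is the running-time distribution of the FMMR perfect sampling algorithm for the move-to-front chain with weight vector $(w_1,\dots,w_n)$ when started from the reversal permutation $(n,n-1,\dots,1)$. *)

theory Defs
  imports "HOL-Probability.Probability"
begin

definition weight_vector :: "nat \<Rightarrow> (nat \<Rightarrow> real) \<Rightarrow> bool" where
  "weight_vector n w \<longleftrightarrow> (\<forall>i\<in>{1..n}. 0 < w i) \<and> (\<Sum>i=1..n. w i) = 1"

definition partial_weight :: "(nat \<Rightarrow> real) \<Rightarrow> nat \<Rightarrow> real" where
  "partial_weight w r = (\<Sum>j=1..r. w j)"

text \<open>The library's \<^const>\<open>geometric_pmf\<close> counts failures and lives on \<open>{0, 1, \<dots>}\<close>;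
  \<open>Geom p\<close> is supported on \<open>{1, 2, \<dots>}\<close>. It is meaningful only for \<open>0 < p \<le> 1\<close>.\<close>

definition Geom :: "real \<Rightarrow> nat pmf" where
  "Geom p = map_pmf Suc (geometric_pmf p)"

text \<open>The convolution of the laws \<open>p i\<close>, \<open>i \<in> I\<close>, for finite \<open>I\<close>: the law of the sum of the
  coordinates under the product distribution.\<close>

definition convolution_pmf :: "'i set \<Rightarrow> ('i \<Rightarrow> nat pmf) \<Rightarrow> nat pmf" where
  "convolution_pmf I p = map_pmf (\<lambda>x. \<Sum>i\<in>I. x i) (Pi_pmf I 0 p)"

definition running_time_law :: "nat \<Rightarrow> (nat \<Rightarrow> real) \<Rightarrow> nat pmf" where
  "running_time_law n w = convolution_pmf {2..n} (\<lambda>r. Geom (partial_weight w r))"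

text \<open>The limit is a constant, so the \<open>n\<close>-th variable may live on its own probability
  space \<open>M n\<close>.\<close>

definition tendsto_in_probability ::
  "(nat \<Rightarrow> 'a measure) \<Rightarrow> (nat \<Rightarrow> 'a \<Rightarrow> real) \<Rightarrow> real \<Rightarrow> bool" where
  "tendsto_in_probability M X c \<longleftrightarrow>
     (\<forall>\<epsilon>>0. (\<lambda>n. measure (M n) {\<omega> \<in> space (M n). \<bar>X n \<omega> - c\<bar> > \<epsilon>}) \<longlonglongrightarrow> 0)"

definition necessary_and_sufficient ::
  "(nat \<Rightarrow> 'a measure) \<Rightarrow> (nat \<Rightarrow> 'a \<Rightarrow> nat) \<Rightarrow> (nat \<Rightarrow> real) \<Rightarrow> bool" where
  "necessary_and_sufficient M T k \<longleftrightarrow>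
     tendsto_in_probability M (\<lambda>n \<omega>. real (T n \<omega>) / k n) 1"

definition gen_harm :: "real \<Rightarrow> nat \<Rightarrow> real" where
  "gen_harm \<alpha> n = (\<Sum>i=1..n. real i powr (- \<alpha>))"

definition power_sum :: "nat \<Rightarrow> real \<Rightarrow> real" where
  "power_sum n s = (\<Sum>j=1..n. real j powr s)"

end

theory Submission
  imports Defs "HOL-Real_Asymp.Real_Asymp"
begin

text \<open>
  By Chebyshev's inequality it suffices to control two moments. Writing \<open>W\<^sub>r\<close> for the partial
  weights, \<open>T\<close> has mean \<open>\<Sum> 1 / W\<^sub>r\<close> and variance at most \<open>\<Sum> 1 / W\<^sub>r\<^sup>2\<close>, which is at most the mean
  divided by \<open>w\<^sub>1\<close> because \<open>W\<^sub>r \<ge> w\<^sub>1\<close>. So \<open>k\<close> steps are necessary and sufficient as soon as the mean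
  is asymptotic to \<open>k\<close> and \<open>w\<^sub>1 k \<rightarrow> \<infinity>\<close>. For the uniform and Zipf weights the mean is
  \<open>V\<^sub>n \<Sum> 1 / V\<^sub>r\<close> with \<open>V\<^sub>r\<close> the unnormalised partial sums, which the Stolz--Cesaro theorem evaluates.
  For the power law, \<open>W\<^sub>r\<close> is close to \<open>r w\<^sub>1\<close> for \<open>r \<le> \<delta> n\<close> and at least \<open>r / n > \<delta>\<close> otherwise. For
  geometric weights \<open>1 / W\<^sub>r - 1\<close> is summable.
\<close>

section \<open>Variance of a sum of independent variables\<close>

text \<open>Independence gives E[XY] = E[X] E[Y], so the cross terms of the variance cancel. Square
  integrability of the sum is concluded too, because the induction over a finite index set feeds the
  sum back in.\<close>

lemma (in prob_space) variance_add_indep: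
  fixes X Y :: "'a \<Rightarrow> real"
  assumes indep: "indep_var borel X borel Y"
    and X: "integrable M (\<lambda>x. (X x)\<^sup>2)" and Y: "integrable M (\<lambda>x. (Y x)\<^sup>2)"
  shows "integrable M (\<lambda>x. (X x + Y x)\<^sup>2)"
    and "variance (\<lambda>x. X x + Y x) = variance X + variance Y"
proof -
  have [measurable]: "X \<in> borel_measurable M" "Y \<in> borel_measurable M"
    using indep_var_rv1[OF indep] indep_var_rv2[OF indep] .
  have iX: "integrable M X" and iY: "integrable M Y"
    using X Y by (auto intro: square_integrable_imp_integrable)
  have iXY: "integrable M (\<lambda>x. X x * Y x)"
    using indep iX iY by (rule indep_var_integrable)
  have eXY: "expectation (\<lambda>x. X x * Y x) = expectation X * expectation Y"
    using indep iX iY by (rule indep_var_lebesgue_integral)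
  have sq: "(X x + Y x)\<^sup>2 = (X x)\<^sup>2 + (Y x)\<^sup>2 + 2 * (X x * Y x)" for x
    by (simp add: power2_sum)
  show iS: "integrable M (\<lambda>x. (X x + Y x)\<^sup>2)"
    unfolding sq using X Y iXY by simp
  show "variance (\<lambda>x. X x + Y x) = variance X + variance Y"
    unfolding variance_eq[OF Bochner_Integration.integrable_add[OF iX iY] iS]
      variance_eq[OF iX X] variance_eq[OF iY Y] sq
    using X Y iX iY iXY by (simp add: eXY power2_sum)
qed

lemma (in prob_space) variance_sum_indep:
  fixes X :: "'i \<Rightarrow> 'a \<Rightarrow> real"
  assumes "finite I" and "indep_vars (\<lambda>_. borel) X I"
    and "\<And>i. i \<in> I \<Longrightarrow> integrable M (\<lambda>x. (X i x)\<^sup>2)"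
  shows "integrable M (\<lambda>x. (\<Sum>i\<in>I. X i x)\<^sup>2) \<and>
    variance (\<lambda>x. \<Sum>i\<in>I. X i x) = (\<Sum>i\<in>I. variance (X i))"
  using assms
proof (induction I rule: finite_induct)
  case (insert i I)
  have IH: "integrable M (\<lambda>x. (\<Sum>i\<in>I. X i x)\<^sup>2) \<and>
      variance (\<lambda>x. \<Sum>i\<in>I. X i x) = (\<Sum>i\<in>I. variance (X i))"
    using insert.prems by (intro insert.IH) (auto intro: indep_vars_subset)
  have indep: "indep_var borel (X i) borel (\<lambda>x. \<Sum>i\<in>I. X i x)"
    using insert by (intro indep_vars_sum) auto
  show ?case
    using variance_add_indep[OF indep] IH insert by simp
qed simp

section \<open>Moments of geometric laws and of their convolutions\<close>

text \<open>The series is the second moment of \<open>Geom p\<close>: \<open>n\<close> counts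
  failures, so the variable takes the value \<open>Suc n\<close>.\<close>

lemma geometric_square_sums:
  fixes p :: real
  assumes "0 < p" "p \<le> 1"
  shows "(\<lambda>n. (1 - p) ^ n * p * (real (Suc n))\<^sup>2) sums ((2 - p) / p\<^sup>2)"
\<comment> \<open>At \<open>p = 1\<close> only the term \<open>n = 0\<close> survives. Otherwise
  \<open>0 < 1 - p < 1\<close>, and the series telescopes.\<close>
proof (cases "p = 1")
  case True
  show ?thesis
    unfolding True using sums_single[of 0 "\<lambda>_. 1::real"]
    by (simp add: power_0_left if_distrib[of "\<lambda>x. x * _"] cong: if_cong)
next
  case False
  define c where "c = 1 - p"
  have c: "0 < c" "c < 1" using assms False by (auto simp: c_def)
  \<comment> \<open>The ansatz \<open>c ^ n\<close> times a quadratic, solved for a telescoping of the summands.\<close>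
  define g where "g n = c ^ n * ((real n)\<^sup>2 + 2 / p * real n + (2 - p) / p\<^sup>2)" for n
  have g0: "g \<longlonglongrightarrow> 0"
    unfolding g_def using c by real_asymp
  have "g n - g (Suc n) = (1 - p) ^ n * p * (real (Suc n))\<^sup>2" for n
    unfolding g_def c_def using assms by (simp add: divide_simps) (simp add: algebra_simps power2_eq_square)
  moreover have "g 0 = (2 - p) / p\<^sup>2" by (simp add: g_def)
  ultimately show ?thesis
    using telescope_sums'[OF g0] by simp
qed

lemma second_moment_Geom:
  assumes "0 < p" "p \<le> 1"
  shows "integrable (Geom p) (\<lambda>n. (real n)\<^sup>2)"
    and "measure_pmf.expectation (Geom p) (\<lambda>n. (real n)\<^sup>2) = (2 - p) / p\<^sup>2"
proof -
  note s = geometric_square_sums[OF assms]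
  have i: "integrable (count_space UNIV) (\<lambda>n. (1 - p) ^ n * p * (real (Suc n))\<^sup>2)"
    using s assms unfolding integrable_count_space_nat_iff by (simp add: sums_iff)
  show "integrable (Geom p) (\<lambda>n. (real n)\<^sup>2)"
    unfolding Geom_def integrable_map_pmf_eq unfolding measure_pmf_eq_density using assms i
    by (subst integrable_density) (auto simp: mult_ac)
  have "measure_pmf.expectation (geometric_pmf p) (\<lambda>n. (real (Suc n))\<^sup>2) = (2 - p) / p\<^sup>2"
    unfolding measure_pmf_eq_density using assms i s
    by (subst integral_density) (auto simp: integral_count_space_nat sums_iff)
  then show "measure_pmf.expectation (Geom p) (\<lambda>n. (real n)\<^sup>2) = (2 - p) / p\<^sup>2"
    by (simp add: Geom_def)
qed

lemma expectation_Geom: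
  assumes "0 < p" "p \<le> 1"
  shows "measure_pmf.expectation (Geom p) real = 1 / p"
  using assms expectation_geometric_pmf[of p] integrable_real_geometric_pmf[of p]
  by (simp add: Geom_def field_simps)

text \<open>The exact variance is \<open>(1 - p) / p\<^sup>2\<close>; the numerator is bounded by
  1.\<close>

lemma variance_Geom_le:
  assumes "0 < p" "p \<le> 1"
  shows "measure_pmf.variance (Geom p) real \<le> 1 / p\<^sup>2"
proof -
  have "integrable (Geom p) real"
    using second_moment_Geom(1)[OF assms] by (rule measure_pmf.square_integrable_imp_integrable[rotated]) simp
  then have "measure_pmf.variance (Geom p) real = (2 - p) / p\<^sup>2 - (1 / p)\<^sup>2"
    using second_moment_Geom[OF assms] expectation_Geom[OF assms]
    by (subst measure_pmf.variance_eq) simp_all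
  also have "\<dots> \<le> 1 / p\<^sup>2"
    using assms by (simp add: field_simps power2_eq_square)
  finally show ?thesis .
qed

text \<open>Under the product law the coordinates are independent with the prescribed marginals, so
  means and variances add. Square integrability is recorded for Chebyshev's inequality.\<close>

lemma convolution_Geom:
  assumes I: "finite I" and p: "\<And>i. i \<in> I \<Longrightarrow> 0 < p i \<and> p i \<le> 1"
  defines "L \<equiv> convolution_pmf I (\<lambda>i. Geom (p i))"
  shows "integrable L (\<lambda>n. (real n)\<^sup>2)"
    and "measure_pmf.expectation L real = (\<Sum>i\<in>I. 1 / p i)"
    and "measure_pmf.variance L real \<le> (\<Sum>i\<in>I. 1 / (p i)\<^sup>2)"
proof -
  define P where "P = Pi_pmf I 0 (\<lambda>i. Geom (p i))"
  have L: "L = map_pmf (\<lambda>x. \<Sum>i\<in>I. x i) P"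
    by (simp add: L_def P_def convolution_pmf_def)
  \<comment> \<open>Reading each \<open>Geom (p i)\<close> as a marginal of \<open>P\<close> turns
    the moments of a single geometric law into moments of coordinates.\<close>
  have comp: "Geom (p i) = map_pmf (\<lambda>x. x i) P" if "i \<in> I" for i
    unfolding P_def using I that by (simp add: Pi_pmf_component)
  have "prob_space.indep_vars P (\<lambda>_. count_space UNIV) (\<lambda>i x. x i) I"
    unfolding P_def by (rule indep_vars_Pi_pmf[OF I])
  then have indep: "prob_space.indep_vars P (\<lambda>_. borel) (\<lambda>i x. real (x i)) I"
    by (rule prob_space.indep_vars_compose2[OF measure_pmf.prob_space_axioms]) simp
  have sq: "integrable P (\<lambda>x. (real (x i))\<^sup>2)" if "i \<in> I" for i
    using second_moment_Geom(1)[of "p i"] p[OF that] by (simp add: comp[OF that])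
  have mean: "measure_pmf.expectation P (\<lambda>x. real (x i)) = 1 / p i" if "i \<in> I" for i
    using expectation_Geom[of "p i"] p[OF that] by (simp add: comp[OF that])
  have var: "measure_pmf.variance P (\<lambda>x. real (x i)) \<le> 1 / (p i)\<^sup>2" if "i \<in> I" for i
    using variance_Geom_le[of "p i"] p[OF that] by (simp add: comp[OF that])
  note V = measure_pmf.variance_sum_indep[OF I indep sq]
  have int: "integrable P (\<lambda>x. real (x i))" if "i \<in> I" for i
    using sq[OF that] by (rule measure_pmf.square_integrable_imp_integrable[rotated]) simp
  show "integrable L (\<lambda>n. (real n)\<^sup>2)"
    using V by (simp add: L)
  show "measure_pmf.expectation L real = (\<Sum>i\<in>I. 1 / p i)"
    using int mean by (simp add: L)
  have "measure_pmf.variance L real = measure_pmf.variance P (\<lambda>x. \<Sum>i\<in>I. real (x i))"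
    by (simp add: L)
  also have "\<dots> \<le> (\<Sum>i\<in>I. 1 / (p i)\<^sup>2)"
    using V var by (auto intro: sum_mono)
  finally show "measure_pmf.variance L real \<le> (\<Sum>i\<in>I. 1 / (p i)\<^sup>2)" .
qed

section \<open>The Stolz-Cesaro theorem and the growth of power sums\<close>

text \<open>Summing the eventual bound on the increments of \<open>a - L * b\<close> leaves a fixed
  constant, which division by \<open>b\<close> removes in the limit. Monotonicity is only eventual
  because \<open>real n / ln (real n)\<close>, a later choice of \<open>b\<close>, increases only
  from some index on.\<close>

lemma stolz_cesaro:
  fixes a b :: "nat \<Rightarrow> real"
  assumes mono: "eventually (\<lambda>n. b n < b (Suc n)) sequentially"
    and b: "filterlim b at_top sequentially"
    and lim: "(\<lambda>n. (a (Suc n) - a n) / (b (Suc n) - b n)) \<longlonglongrightarrow> L"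
  shows "(\<lambda>n. a n / b n) \<longlonglongrightarrow> L"
proof (rule tendstoI)
  fix e :: real assume e: "e > 0"
  define c where "c n = a n - L * b n" for n
  have "eventually (\<lambda>n. dist ((a (Suc n) - a n) / (b (Suc n) - b n)) L < e / 2) sequentially"
    using lim e by (auto dest: tendstoD[where e = "e / 2"])
  with mono have "eventually (\<lambda>n. \<bar>c (Suc n) - c n\<bar> \<le> e / 2 * (b (Suc n) - b n)) sequentially"
  proof eventually_elim
    case (elim n)
    define D where "D = b (Suc n) - b n"
    have D: "D > 0" using elim by (simp add: D_def)
    have "c (Suc n) - c n = ((a (Suc n) - a n) / D - L) * D"
      using D by (simp add: c_def D_def field_simps)
    then have "\<bar>c (Suc n) - c n\<bar> = \<bar>(a (Suc n) - a n) / D - L\<bar> * D"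
      using D by (simp add: abs_mult)
    also have "\<dots> \<le> e / 2 * D"
      using elim D by (intro mult_right_mono) (auto simp: dist_real_def D_def)
    finally show ?case by (simp add: D_def)
  qed
  then obtain N where N: "\<And>n. n \<ge> N \<Longrightarrow> \<bar>c (Suc n) - c n\<bar> \<le> e / 2 * (b (Suc n) - b n)"
    by (auto simp: eventually_sequentially)
  have inc: "\<bar>c n - c N\<bar> \<le> e / 2 * (b n - b N)" if "n \<ge> N" for n
    using that
  proof (induction n rule: dec_induct)
    case (step n)
    have "\<bar>c (Suc n) - c N\<bar> \<le> \<bar>c (Suc n) - c n\<bar> + \<bar>c n - c N\<bar>" by linarith
    also have "\<dots> \<le> e / 2 * (b (Suc n) - b n) + e / 2 * (b n - b N)"
      using step N by (intro add_mono) auto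
    finally show ?case by (simp add: field_simps)
  qed simp
  \<comment> \<open>Half of \<open>e\<close> pays for the increments since \<open>N\<close>; the
    threshold makes the other half outweigh the constant left at \<open>N\<close>. The maximum with
    0 makes \<open>b n\<close> positive.\<close>
  have "eventually (\<lambda>n. b n > max 0 ((\<bar>c N\<bar> - e / 2 * b N) / (e / 2))) sequentially"
    using b unfolding filterlim_at_top_dense by blast
  then show "eventually (\<lambda>n. dist (a n / b n) L < e) sequentially"
    using eventually_ge_at_top[of N]
  proof eventually_elim
    case (elim n)
    have b0: "b n > 0" and "(\<bar>c N\<bar> - e / 2 * b N) / (e / 2) < b n" using elim by auto
    then have *: "\<bar>c N\<bar> - e / 2 * b N < e / 2 * b n"
      using e by (simp add: pos_divide_less_eq mult_ac)
    have "\<bar>c n\<bar> \<le> \<bar>c N\<bar> + e / 2 * (b n - b N)"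
      using inc[of n] elim by linarith
    also have "\<dots> < e * b n"
      using * by (simp add: field_simps)
    finally have "\<bar>c n\<bar> / b n < e" using b0 by (simp add: field_simps)
    moreover have "a n / b n - L = c n / b n"
      using b0 by (simp add: c_def field_simps)
    ultimately show ?case using b0 by (simp add: dist_real_def)
  qed
qed

lemma harm_asymp: "(\<lambda>n. harm n / ln (real n)) \<longlonglongrightarrow> (1::real)"
proof (rule stolz_cesaro)
  have "(\<lambda>n. inverse (real n + 1) / (ln (real n + 1) - ln (real n))) \<longlonglongrightarrow> 1"
    by real_asymp
  then show "(\<lambda>n. (harm (Suc n) - harm n) / (ln (real (Suc n)) - ln (real n))) \<longlonglongrightarrow> (1::real)"
    by (simp add: harm_Suc add_ac)
qed real_asymp+

lemma gen_harm_Suc: "gen_harm \<alpha> (Suc n) = gen_harm \<alpha> n + (real n + 1) powr (- \<alpha>)"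
  by (simp add: gen_harm_def add_ac)

lemma gen_harm_1: "gen_harm 1 n = harm n"
  by (simp add: gen_harm_def harm_def powr_minus)

text \<open>The comparison function is the integral of \<open>x powr (- \<alpha>)\<close> over
  \<open>[0, n]\<close>; its increments match the summands to leading order.\<close>

lemma gen_harm_asymp:
  assumes "0 < \<alpha>" "\<alpha> < 1"
  shows "(\<lambda>n. gen_harm \<alpha> n / (real n powr (1 - \<alpha>) / (1 - \<alpha>))) \<longlonglongrightarrow> 1"
proof (rule stolz_cesaro)
  define b where "b = 1 - \<alpha>"
  have b: "0 < b" "b < 1" and \<alpha>: "\<alpha> = 1 - b" using assms by (auto simp: b_def)
  have "eventually (\<lambda>n. real n powr b / b < (real n + 1) powr b / b) sequentially"
    using b by real_asymp
  then show "eventually (\<lambda>n. real n powr (1 - \<alpha>) / (1 - \<alpha>) < real (Suc n) powr (1 - \<alpha>) / (1 - \<alpha>)) sequentially"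
    by (simp add: \<alpha> add_ac)
  show "filterlim (\<lambda>n. real n powr (1 - \<alpha>) / (1 - \<alpha>)) at_top sequentially"
    unfolding \<alpha> using b by real_asymp
  have "(\<lambda>n. (real n + 1) powr (b - 1) / ((real n + 1) powr b / b - real n powr b / b)) \<longlonglongrightarrow> 1"
    using b by real_asymp
  then show "(\<lambda>n. (gen_harm \<alpha> (Suc n) - gen_harm \<alpha> n) /
      (real (Suc n) powr (1 - \<alpha>) / (1 - \<alpha>) - real n powr (1 - \<alpha>) / (1 - \<alpha>))) \<longlonglongrightarrow> 1"
    by (simp add: gen_harm_Suc \<alpha> add_ac)
qed

text \<open>Again the comparison function is an integral, that of \<open>x powr s\<close> over
  \<open>[0, n]\<close>.\<close>

lemma power_sum_asymp:
  assumes "0 < s"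
  shows "(\<lambda>n. power_sum n s / (real n powr (s + 1) / (s + 1))) \<longlonglongrightarrow> 1"
proof (rule stolz_cesaro)
  have "eventually (\<lambda>n. real n powr (s + 1) / (s + 1) < (real n + 1) powr (s + 1) / (s + 1)) sequentially"
    using assms by real_asymp
  then show "eventually (\<lambda>n. real n powr (s + 1) / (s + 1) < real (Suc n) powr (s + 1) / (s + 1)) sequentially"
    by (simp add: add_ac)
  show "filterlim (\<lambda>n. real n powr (s + 1) / (s + 1)) at_top sequentially"
    using assms by real_asymp
  have "(\<lambda>n. (real n + 1) powr s / ((real n + 1) powr (s + 1) / (s + 1) - real n powr (s + 1) / (s + 1))) \<longlonglongrightarrow> 1"
    using assms by real_asymp
  then show "(\<lambda>n. (power_sum (Suc n) s - power_sum n s) /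
      (real (Suc n) powr (s + 1) / (s + 1) - real n powr (s + 1) / (s + 1))) \<longlonglongrightarrow> 1"
    by (simp add: power_sum_def add_ac)
qed

text \<open>The limit is the value of the Riemann zeta function at \<alpha>. Being positive, it can
  serve as a constant growth function of the partial sums.\<close>

lemma gen_harm_convergent:
  assumes "1 < \<alpha>"
  obtains z where "z > 0" "(gen_harm \<alpha>) \<longlonglongrightarrow> z"
proof -
  have "summable (\<lambda>n. real n powr (- \<alpha>))"
    using assms by (simp add: summable_real_powr_iff)
  then have lim: "(\<lambda>n. \<Sum>i\<le>n. real i powr (- \<alpha>)) \<longlonglongrightarrow> (\<Sum>n. real n powr (- \<alpha>))"
    by (rule summable_LIMSEQ')
  \<comment> \<open>The index 0 contributes nothing because
    \<open>0 powr (- \<alpha>) = 0\<close>.\<close>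
  have eq: "(\<lambda>n. \<Sum>i\<le>n. real i powr (- \<alpha>)) = gen_harm \<alpha>"
    by (auto simp: gen_harm_def atMost_atLeast0 sum.atLeast_Suc_atMost)
  have "(\<Sum>n. real n powr (- \<alpha>)) > 0"
    using \<open>summable _\<close> by (rule suminf_pos2[where i = 1]) auto
  with lim show ?thesis unfolding eq by (rule that[rotated])
qed

section \<open>Concentration of the running time around its mean\<close>

text \<open>The last two bounds make the partial weight a valid parameter of \<open>Geom\<close>;
  the first one controls the variance.\<close>

lemma partial_weight_bounds:
  assumes "weight_vector n w" "1 \<le> r" "r \<le> n"
  shows "w 1 \<le> partial_weight w r" "0 < partial_weight w r" "partial_weight w r \<le> 1"
proof -
  have pos: "\<And>i. i \<in> {1..n} \<Longrightarrow> 0 < w i" and total: "(\<Sum>i=1..n. w i) = 1"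
    using assms(1) by (auto simp: weight_vector_def)
  show "w 1 \<le> partial_weight w r"
    unfolding partial_weight_def using assms(2,3) pos by (intro member_le_sum) (auto simp: less_imp_le)
  then show "0 < partial_weight w r"
    using pos[of 1] assms(2,3) by auto
  have "partial_weight w r \<le> (\<Sum>i=1..n. w i)"
    unfolding partial_weight_def using assms(3) pos by (intro sum_mono2) (auto simp: less_imp_le)
  then show "partial_weight w r \<le> 1"
    using total by simp
qed

text \<open>Chebyshev's inequality around the mean \<open>m\<close> with radius
  \<open>\<epsilon> / 2 * k\<close>; the other half of \<epsilon> absorbs the bias of
  \<open>m / k\<close>. The bound is grouped so that \<open>m / k\<close> will converge and
  \<open>w 1 * k\<close> will diverge.\<close>

lemma running_time_tail_le:
  assumes w: "weight_vector n w" and n: "2 \<le> n" and k: "0 < k" and \<epsilon>: "0 < \<epsilon>"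
  defines "m \<equiv> (\<Sum>r=2..n. 1 / partial_weight w r)"
  assumes close: "\<bar>m / k - 1\<bar> < \<epsilon> / 2"
  shows "measure (running_time_law n w) {t. \<bar>real t / k - 1\<bar> > \<epsilon>}
    \<le> 4 / \<epsilon>\<^sup>2 * (m / k) / (w 1 * k)"
proof -
  let ?L = "running_time_law n w" and ?W = "partial_weight w"
  have W: "w 1 \<le> ?W r" "0 < ?W r" "?W r \<le> 1" if "r \<in> {2..n}" for r
    using that partial_weight_bounds[OF w, of r] by auto
  have w1: "0 < w 1" using w n by (simp add: weight_vector_def)
  have L: "integrable ?L (\<lambda>t. (real t)\<^sup>2)" "measure_pmf.expectation ?L real = m"
    "measure_pmf.variance ?L real \<le> (\<Sum>r=2..n. 1 / (?W r)\<^sup>2)"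
    unfolding running_time_law_def m_def
    using convolution_Geom[of "{2..n}" ?W] W by auto
  \<comment> \<open>One factor \<open>1 / ?W r\<close> is bounded by \<open>1 / w 1\<close>; the
    other is kept, so that the sum is again \<open>m\<close>.\<close>
  have "(\<Sum>r=2..n. 1 / (?W r)\<^sup>2) \<le> (\<Sum>r=2..n. 1 / ?W r * (1 / w 1))"
  proof (rule sum_mono)
    fix r assume "r \<in> {2..n}"
    then show "1 / (?W r)\<^sup>2 \<le> 1 / ?W r * (1 / w 1)"
      using W[of r] w1 by (simp add: power2_eq_square frac_le mult_left_mono)
  qed
  also have "\<dots> = m / w 1"
    by (simp only: m_def sum_distrib_right[symmetric]) simp
  finally have var: "measure_pmf.variance ?L real \<le> m / w 1"
    using L(3) by linarith
  have "{t. \<bar>real t / k - 1\<bar> > \<epsilon>} \<subseteq> {t. \<bar>real t - m\<bar> \<ge> \<epsilon> / 2 * k}"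
  proof safe
    fix t :: nat assume "\<bar>real t / k - 1\<bar> > \<epsilon>"
    then have "\<epsilon> / 2 \<le> \<bar>real t / k - m / k\<bar>"
      using close by linarith
    also have "\<dots> = \<bar>real t - m\<bar> / k"
      using k by (simp add: diff_divide_distrib[symmetric])
    finally show "\<epsilon> / 2 * k \<le> \<bar>real t - m\<bar>"
      using k by (simp add: pos_le_divide_eq)
  qed
  then have "measure ?L {t. \<bar>real t / k - 1\<bar> > \<epsilon>} \<le> measure ?L {t. \<bar>real t - m\<bar> \<ge> \<epsilon> / 2 * k}"
    by (intro measure_pmf.finite_measure_mono) auto
  also have "\<dots> \<le> measure_pmf.variance ?L real / (\<epsilon> / 2 * k)\<^sup>2"
    using measure_pmf.Chebyshev_inequality[of real ?L "\<epsilon> / 2 * k"] L(1,2) \<epsilon> k by simp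
  also have "\<dots> \<le> (m / w 1) / (\<epsilon> / 2 * k)\<^sup>2"
    by (intro divide_right_mono var) simp
  also have "\<dots> = 4 / \<epsilon>\<^sup>2 * (m / k) / (w 1 * k)"
    using \<epsilon> k w1 by (simp add: field_simps power2_eq_square)
  finally show ?thesis .
qed

text \<open>Bundles the hypotheses shared by all families of weights. Indices below 2 stay
  unconstrained, so the limits are taken through eventual statements.\<close>

definition has_running_time :: "(nat \<Rightarrow> nat \<Rightarrow> real) \<Rightarrow> (nat \<Rightarrow> 'a measure) \<Rightarrow> (nat \<Rightarrow> 'a \<Rightarrow> nat) \<Rightarrow> bool" where
  "has_running_time w M T \<longleftrightarrow> (\<forall>n\<ge>2. weight_vector n (w n) \<and> T n \<in> measurable (M n) (count_space UNIV) \<and>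
     distr (M n) (count_space UNIV) (T n) = measure_pmf (running_time_law n (w n)))"

text \<open>The tail bound is a convergent quantity divided by a divergent one, so the tail is
  squeezed to 0.\<close>

lemma necessary_and_sufficientI:
  assumes T: "has_running_time w M T"
    and mean: "(\<lambda>n. (\<Sum>r=2..n. 1 / partial_weight (w n) r) / k n) \<longlonglongrightarrow> 1"
    and first: "filterlim (\<lambda>n. w n 1 * k n) at_top sequentially"
  shows "necessary_and_sufficient M T k"
  unfolding necessary_and_sufficient_def tendsto_in_probability_def
proof (intro allI impI)
  fix \<epsilon> :: real assume \<epsilon>: "\<epsilon> > 0"
  let ?R = "\<lambda>n. (\<Sum>r=2..n. 1 / partial_weight (w n) r) / k n"
  let ?P = "\<lambda>n. measure (M n) {\<omega> \<in> space (M n). \<bar>real (T n \<omega>) / k n - 1\<bar> > \<epsilon>}"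
  have "eventually (\<lambda>n. dist (?R n) 1 < \<epsilon> / 2) sequentially"
    using mean \<epsilon> by (auto dest: tendstoD[where e = "\<epsilon> / 2"])
  \<comment> \<open>Positivity of \<open>k n\<close>, required by the tail bound, follows from this
    and \<open>w n 1 > 0\<close>.\<close>
  moreover have "eventually (\<lambda>n. w n 1 * k n > 0) sequentially"
    using first unfolding filterlim_at_top_dense by blast
  ultimately have bound: "eventually (\<lambda>n. ?P n \<le> 4 / \<epsilon>\<^sup>2 * ?R n / (w n 1 * k n)) sequentially"
    using eventually_ge_at_top[of 2]
  proof eventually_elim
    case (elim n)
    let ?B = "{t. \<bar>real t / k n - 1\<bar> > \<epsilon>}"
    have w: "weight_vector n (w n)" and [measurable]: "T n \<in> measurable (M n) (count_space UNIV)"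
      and law: "distr (M n) (count_space UNIV) (T n) = measure_pmf (running_time_law n (w n))"
      using T elim(3) by (auto simp: has_running_time_def)
    have "0 < w n 1" using w elim(3) by (simp add: weight_vector_def)
    then have k: "0 < k n" using elim(2) by (simp add: zero_less_mult_iff)
    \<comment> \<open>The tail probability depends on \<open>T n\<close> only through its law, so it
      can be computed under \<open>running_time_law\<close>.\<close>
    have "?P n = measure (distr (M n) (count_space UNIV) (T n)) ?B"
      by (subst measure_distr) (auto intro!: arg_cong[where f = "measure (M n)"])
    also have "\<dots> \<le> 4 / \<epsilon>\<^sup>2 * ?R n / (w n 1 * k n)"
      unfolding law using elim(1) by (intro running_time_tail_le w elim k \<epsilon>) (simp add: dist_real_def)
    finally show ?case .
  qed
  have "(\<lambda>n. 4 / \<epsilon>\<^sup>2 * ?R n / (w n 1 * k n)) \<longlonglongrightarrow> 0"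
    by (rule real_tendsto_divide_at_top[OF tendsto_mult[OF tendsto_const mean] first])
  then show "?P \<longlonglongrightarrow> 0"
    by (intro tendsto_sandwich[OF _ bound tendsto_const]) auto
qed

section \<open>Weights obtained by normalising a fixed sequence\<close>

text \<open>Here \<open>g\<close> is the growth of the unnormalised partial sums and \<open>G\<close> an asymptotic antiderivative of
  \<open>1 / g\<close>.\<close>

lemma necessary_and_sufficient_scaled_weights:
  fixes v g G k :: "nat \<Rightarrow> real"
  assumes T: "has_running_time w M T"
    and v: "\<And>i. i \<ge> 1 \<Longrightarrow> v i > 0"
    and w: "\<And>n i. n \<ge> 2 \<Longrightarrow> i \<in> {1..n} \<Longrightarrow> w n i = v i / (\<Sum>j=1..n. v j)"
    and g: "(\<lambda>n. (\<Sum>j=1..n. v j) / g n) \<longlonglongrightarrow> 1"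
    and G_mono: "eventually (\<lambda>n. G n < G (Suc n)) sequentially"
    and G_top: "filterlim G at_top sequentially"
    and G: "(\<lambda>n. 1 / g (Suc n) / (G (Suc n) - G n)) \<longlonglongrightarrow> 1"
    and k: "eventually (\<lambda>n. k n = g n * G n) sequentially"
  shows "necessary_and_sufficient M T k"
proof -
  define V where "V n = (\<Sum>j=1..n. v j)" for n
  define A where "A n = (\<Sum>r=2..n. 1 / V r)" for n
  have V_pos: "V n > 0" if "n \<ge> 1" for n
    unfolding V_def using v that by (intro sum_pos) auto
  have Vg: "(\<lambda>n. V n / g n) \<longlonglongrightarrow> 1" using g by (simp add: V_def)
  have gV: "(\<lambda>n. g n / V n) \<longlonglongrightarrow> 1"
    using tendsto_inverse[OF Vg] by simp
  \<comment> \<open>Division by 0 yields 0, so a positive quotient forces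
    \<open>g n \<noteq> 0\<close>.\<close>
  have "eventually (\<lambda>n. V n / g n > 0) sequentially"
    using Vg by (rule order_tendstoD) simp
  then have g_nz: "eventually (\<lambda>n. g n \<noteq> 0) sequentially"
    by eventually_elim auto
  \<comment> \<open>The increment \<open>1 / V (Suc n)\<close> of \<open>A\<close> is asymptotic to
    \<open>1 / g (Suc n)\<close>, hence to the increment of \<open>G\<close>.\<close>
  have "(\<lambda>n. g (Suc n) / V (Suc n) * (1 / g (Suc n) / (G (Suc n) - G n))) \<longlonglongrightarrow> 1 * 1"
    by (intro tendsto_mult G LIMSEQ_Suc[OF gV])
  \<comment> \<open>\<open>A\<close> sums from \<open>r = 2\<close>, so its increment is
    \<open>1 / V (Suc n)\<close> only from \<open>n = 1\<close> on.\<close>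
  moreover have "eventually (\<lambda>n. g (Suc n) / V (Suc n) * (1 / g (Suc n) / (G (Suc n) - G n))
      = (A (Suc n) - A n) / (G (Suc n) - G n)) sequentially"
    using eventually_compose_filterlim[OF g_nz filterlim_Suc] eventually_ge_at_top[of 1]
    by eventually_elim (simp add: A_def)
  ultimately have "(\<lambda>n. (A (Suc n) - A n) / (G (Suc n) - G n)) \<longlonglongrightarrow> 1"
    by (auto intro: Lim_transform_eventually)
  then have AG: "(\<lambda>n. A n / G n) \<longlonglongrightarrow> 1"
    by (rule stolz_cesaro[OF G_mono G_top])
  show ?thesis
  proof (rule necessary_and_sufficientI[OF T])
    \<comment> \<open>Normalisation divides every partial sum by \<open>V n\<close>, so the mean is
      \<open>V n * A n\<close>, which is asymptotic to \<open>g n * G n\<close>.\<close>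
    have W: "partial_weight (w n) r = V r / V n" if "n \<ge> 2" "r \<le> n" for n r
      using that by (simp add: partial_weight_def V_def w sum_divide_distrib)
    have "(\<lambda>n. V n / g n * (A n / G n)) \<longlonglongrightarrow> 1 * 1"
      by (intro tendsto_mult Vg AG)
    moreover have "eventually (\<lambda>n. V n / g n * (A n / G n)
        = (\<Sum>r=2..n. 1 / partial_weight (w n) r) / k n) sequentially"
      using k eventually_ge_at_top[of 2]
    proof eventually_elim
      case (elim n)
      have "(\<Sum>r=2..n. 1 / partial_weight (w n) r) = V n * A n"
        unfolding A_def sum_distrib_left using elim W by (intro sum.cong) auto
      then show ?case using elim by simp
    qed
    ultimately show "(\<lambda>n. (\<Sum>r=2..n. 1 / partial_weight (w n) r) / k n) \<longlonglongrightarrow> 1"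
      by (auto intro: Lim_transform_eventually)
    \<comment> \<open>Since \<open>w n 1 = v 1 / V n\<close>, the product \<open>w n 1 * k n\<close>
      behaves like \<open>v 1 * G n\<close>.\<close>
    have "filterlim (\<lambda>n. v 1 * (g n / V n) * G n) at_top sequentially"
      using v[of 1] by (intro filterlim_tendsto_pos_mult_at_top[OF tendsto_mult[OF tendsto_const gV] _ G_top]) auto
    moreover have "eventually (\<lambda>n. v 1 * (g n / V n) * G n = w n 1 * k n) sequentially"
      using k eventually_ge_at_top[of 2] by eventually_elim (simp add: w V_def)
    ultimately show "filterlim (\<lambda>n. w n 1 * k n) at_top sequentially"
      by (rule iffD1[OF filterlim_cong[OF refl refl], rotated])
  qed
qed

section \<open>Power-law weights\<close>

text \<open>The first \<open>r\<close> weights are at least \<open>w r\<close> and the others at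
  most \<open>w r\<close>, so the average of the first \<open>r\<close> is at least the overall
  average \<open>1 / n\<close>.\<close>

lemma partial_weight_ge_average:
  assumes w: "weight_vector n w" and r: "1 \<le> r" "r \<le> n"
    and antimono: "\<And>i j. 1 \<le> i \<Longrightarrow> i \<le> j \<Longrightarrow> j \<le> n \<Longrightarrow> w j \<le> w i"
  shows "real r / real n \<le> partial_weight w r"
proof -
  let ?W = "partial_weight w r"
  have "1 = (\<Sum>j=1..r + (n - r). w j)"
    using w r by (simp add: weight_vector_def)
  also have "\<dots> = ?W + (\<Sum>j=r+1..r + (n - r). w j)"
    unfolding partial_weight_def by (rule sum.ub_add_nat) simp
  also have "(\<Sum>j=r+1..r + (n - r). w j) \<le> (\<Sum>j=r+1..r + (n - r). w r)"
    using r by (intro sum_mono antimono) auto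
  finally have total: "1 \<le> ?W + (real n - real r) * w r"
    using r by (simp add: of_nat_diff)
  have "(\<Sum>j=1..r. w r) \<le> ?W"
    unfolding partial_weight_def using r by (intro sum_mono antimono) auto
  then have "real r * w r \<le> ?W" by simp
  \<comment> \<open>With \<open>total\<close> this gives
    \<open>r \<le> r * ?W + (n - r) * (r * w r) \<le> n * ?W\<close>.\<close>
  then have "(real n - real r) * (real r * w r) \<le> (real n - real r) * ?W"
    using r by (intro mult_left_mono) auto
  moreover have "real r * 1 \<le> real r * (?W + (real n - real r) * w r)"
    using total by (intro mult_left_mono) auto
  ultimately have "real r \<le> real n * ?W"
    by (simp add: algebra_simps)
  then show ?thesis using r by (simp add: field_simps)
qed

text \<open>Here \<open>c\<close> is \<open>1 / w 1\<close>, and the lower bound says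
  \<open>partial_weight w r \<le> r * w 1\<close>. In the upper bound one summand suffices in each
  range: for \<open>r \<le> \<delta> * n\<close> the first \<open>r\<close> weights are at least
  \<open>(1 - \<delta>) powr s * w 1\<close>, and for larger \<open>r\<close> the partial weight is
  at least \<open>r / n > \<delta>\<close>.\<close>

lemma power_law_partial_weight_bounds:
  assumes wv: "weight_vector n w" and s: "0 < s" and r: "1 \<le> r" "r \<le> n"
    and w: "\<And>i. i \<in> {1..n} \<Longrightarrow> w i = (real n - real i + 1) powr s / power_sum n s"
    and \<delta>: "0 < \<delta>" "\<delta> < 1"
  defines "c \<equiv> power_sum n s / real n powr s"
  shows "c * (1 / real r) \<le> 1 / partial_weight w r"
    and "1 / partial_weight w r \<le> (1 - \<delta>) powr (- s) * c * (1 / real r) + 1 / \<delta>"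
proof -
  let ?W = "partial_weight w r"
  have F: "power_sum n s > 0"
    unfolding power_sum_def using r by (intro sum_pos) auto
  have n: "real n > 0" using r by simp
  have c: "c > 0" using F n by (simp add: c_def)
  have W: "?W > 0" using partial_weight_bounds[OF wv r] by simp
  have "?W \<le> (\<Sum>j=1..r. 1 / c)"
    unfolding partial_weight_def using F r s
    by (intro sum_mono) (auto simp: w c_def intro!: divide_right_mono powr_mono2)
  then have "?W \<le> real r / c" by simp
  then have "1 / (real r / c) \<le> 1 / ?W"
    using W c r by (intro divide_left_mono) auto
  then show "c * (1 / real r) \<le> 1 / ?W" by simp
  have nonneg: "0 \<le> (1 - \<delta>) powr (- s) * c * (1 / real r)" using c by simp
  show "1 / ?W \<le> (1 - \<delta>) powr (- s) * c * (1 / real r) + 1 / \<delta>"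
  proof (cases "real r \<le> \<delta> * real n")
    case True
    have "(\<Sum>j=1..r. (1 - \<delta>) powr s / c) \<le> ?W"
      unfolding partial_weight_def
    proof (rule sum_mono)
      fix j assume j: "j \<in> {1..r}"
      have "(1 - \<delta>) powr s / c = ((1 - \<delta>) * real n) powr s / power_sum n s"
        using \<delta> n by (simp add: c_def powr_mult)
      \<comment> \<open>From \<open>j \<le> r \<le> \<delta> * n\<close> it follows that
        \<open>n - j + 1 \<ge> (1 - \<delta>) * n\<close>.\<close>
      also have "\<dots> \<le> w j"
        using j r True \<delta> F s n
        by (auto simp: w algebra_simps intro!: divide_right_mono powr_mono2)
      finally show "(1 - \<delta>) powr s / c \<le> w j" .
    qed
    then have "1 / ?W \<le> 1 / (real r * ((1 - \<delta>) powr s / c))"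
      using W c r \<delta> by (intro divide_left_mono) auto
    also have "\<dots> = (1 - \<delta>) powr (- s) * c * (1 / real r)"
      using c \<delta> by (simp add: powr_minus field_simps)
    finally show ?thesis using \<delta> by (simp add: add_increasing2)
  next
    case False
    have "\<delta> \<le> real r / real n"
      using False n by (simp add: field_simps)
    also have "\<dots> \<le> ?W"
      using F s by (intro partial_weight_ge_average[OF wv r])
        (auto simp: w intro!: divide_right_mono powr_mono2)
    finally have "1 / ?W \<le> 1 / \<delta>"
      using \<delta> W by (intro divide_left_mono) auto
    then show ?thesis using nonneg by linarith
  qed
qed

lemma sum_inverse_eq_harm: "n \<ge> 1 \<Longrightarrow> (\<Sum>r=2..n. 1 / real r) = harm n - 1"
  by (simp add: harm_def sum.atLeast_Suc_atMost[of "Suc 0" n] divide_inverse numeral_2_eq_2)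

text \<open>Summing the bounds on \<open>1 / partial_weight\<close> encloses the mean between two
  multiples of \<open>c n * (harm n - 1)\<close>, up to an error \<open>n / \<delta> n\<close>. As
  \<open>c n\<close> is asymptotic to \<open>n / (s + 1)\<close> and \<open>harm n\<close> to
  \<open>ln n\<close>, both ends are asymptotic to \<open>n * ln n / (s + 1)\<close>.\<close>

lemma necessary_and_sufficient_power_law:
  assumes T: "has_running_time w M T" and s: "0 < s"
    and w: "\<And>n i. n \<ge> 2 \<Longrightarrow> i \<in> {1..n} \<Longrightarrow> w n i = (real n - real i + 1) powr s / power_sum n s"
  shows "necessary_and_sufficient M T (\<lambda>n. real n * ln (real n) / (s + 1))"
proof (rule necessary_and_sufficientI[OF T])
  define k where "k n = real n * ln (real n) / (s + 1)" for n :: nat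
  \<comment> \<open>Both \<open>\<delta> \<rightarrow> 0\<close> and \<open>n / \<delta> = o(n ln n)\<close> are needed.\<close>
  define \<delta> where "\<delta> n = 1 / sqrt (ln (real n))" for n :: nat
  define c where "c n = power_sum n s / real n powr s" for n :: nat
  define m where "m n = (\<Sum>r=2..n. 1 / partial_weight (w n) r)" for n
  have wv: "weight_vector n (w n)" if "n \<ge> 2" for n
    using T that by (auto simp: has_running_time_def)
  have "(\<lambda>n. power_sum n s / (real n powr (s + 1) / (s + 1))) \<longlonglongrightarrow> 1"
    using s by (rule power_sum_asymp)
  then have R: "(\<lambda>n. c n * (s + 1) / real n) \<longlonglongrightarrow> 1"
    by (simp add: c_def powr_add mult_ac)
  have "(\<lambda>n. harm n / ln (real n) - 1 / ln (real n)) \<longlonglongrightarrow> 1 - (0::real)"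
    by (intro tendsto_diff harm_asymp) real_asymp
  then have H: "(\<lambda>n. (harm n - 1) / ln (real n)) \<longlonglongrightarrow> (1::real)"
    by (simp add: diff_divide_distrib)
  have "eventually (\<lambda>n. 0 < \<delta> n \<and> \<delta> n < 1) sequentially"
    unfolding \<delta>_def eventually_conj_iff by (intro conjI; real_asymp)
  with eventually_ge_at_top[of 2]
  have "eventually (\<lambda>n. c n * (harm n - 1) \<le> m n \<and>
      m n \<le> (1 - \<delta> n) powr (- s) * (c n * (harm n - 1)) + real n / \<delta> n) sequentially"
  proof eventually_elim
    case (elim n)
    note b = power_law_partial_weight_bounds[OF wv[OF elim(1)] s _ _ w[OF elim(1)], of _ "\<delta> n"]
    have "c n * (harm n - 1) = (\<Sum>r=2..n. c n * (1 / real r))"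
      using elim by (simp only: sum_distrib_left[symmetric]) (simp add: sum_inverse_eq_harm)
    also have "\<dots> \<le> m n"
      unfolding m_def c_def using elim by (intro sum_mono b) auto
    finally have lower: "c n * (harm n - 1) \<le> m n" .
    have "m n \<le> (\<Sum>r=2..n. (1 - \<delta> n) powr (- s) * c n * (1 / real r) + 1 / \<delta> n)"
      unfolding m_def c_def using elim by (intro sum_mono b) auto
    also have "\<dots> = (1 - \<delta> n) powr (- s) * c n * (\<Sum>r=2..n. 1 / real r) + real (n - 1) / \<delta> n"
      by (simp add: sum.distrib sum_distrib_left)
    also have "\<dots> \<le> (1 - \<delta> n) powr (- s) * (c n * (harm n - 1)) + real n / \<delta> n"
      using elim by (simp add: sum_inverse_eq_harm divide_right_mono)
    finally show ?case using lower by simp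
  qed
  with eventually_ge_at_top[of 2]
  have "eventually (\<lambda>n. c n * (s + 1) / real n * ((harm n - 1) / ln (real n)) \<le> m n / k n) sequentially
    \<and> eventually (\<lambda>n. m n / k n \<le> (1 - \<delta> n) powr (- s) *
        (c n * (s + 1) / real n * ((harm n - 1) / ln (real n))) + (s + 1) / (\<delta> n * ln (real n))) sequentially"
    unfolding eventually_conj_iff[symmetric]
  proof eventually_elim
    case (elim n)
    have k: "k n > 0" and n: "real n > 0" "ln (real n) > 0" using elim s by (auto simp: k_def)
    have "c n * (harm n - 1) / k n \<le> m n / k n"
      "m n / k n \<le> ((1 - \<delta> n) powr (- s) * (c n * (harm n - 1)) + real n / \<delta> n) / k n"
      using elim k by (auto intro: divide_right_mono)
    moreover have "c n * (harm n - 1) / k n = c n * (s + 1) / real n * ((harm n - 1) / ln (real n))"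
      by (simp add: k_def mult_ac)
    moreover have "real n / \<delta> n / k n = (s + 1) / (\<delta> n * ln (real n))"
      using n s by (simp add: k_def)
    ultimately show ?case
      by (metis add_divide_distrib times_divide_eq_right)
  qed
  moreover have "(\<lambda>n. c n * (s + 1) / real n * ((harm n - 1) / ln (real n))) \<longlonglongrightarrow> 1 * 1"
    by (intro tendsto_mult R H)
  moreover have "(\<lambda>n. (1 - \<delta> n) powr (- s) * (c n * (s + 1) / real n * ((harm n - 1) / ln (real n)))
      + (s + 1) / (\<delta> n * ln (real n))) \<longlonglongrightarrow> 1 * (1 * 1) + 0"
  proof (intro tendsto_add tendsto_mult R H)
    show "(\<lambda>n. (1 - \<delta> n) powr (- s)) \<longlonglongrightarrow> 1" unfolding \<delta>_def by real_asymp
    \<comment> \<open>By the choice of \<open>\<delta> n\<close> this relative error is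
      \<open>(s + 1) / sqrt (ln n)\<close>.\<close>
    show "(\<lambda>n. (s + 1) / (\<delta> n * ln (real n))) \<longlonglongrightarrow> 0" unfolding \<delta>_def by real_asymp
  qed
  ultimately have "(\<lambda>n. m n / k n) \<longlonglongrightarrow> 1"
    by (auto intro: tendsto_sandwich)
  then show "(\<lambda>n. (\<Sum>r=2..n. 1 / partial_weight (w n) r) / (real n * ln (real n) / (s + 1))) \<longlonglongrightarrow> 1"
    by (simp add: m_def k_def)
  \<comment> \<open>As \<open>w n 1 = 1 / c n\<close>, the product of the first weight with the step
    count is asymptotic to \<open>ln n\<close>.\<close>
  have "filterlim (\<lambda>n. inverse (c n * (s + 1) / real n) * ln (real n)) at_top sequentially"
    by (intro filterlim_tendsto_pos_mult_at_top[OF tendsto_inverse[OF R]]) (simp, simp, real_asymp)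
  moreover have "eventually (\<lambda>n. inverse (c n * (s + 1) / real n) * ln (real n)
      = w n 1 * (real n * ln (real n) / (s + 1))) sequentially"
    using eventually_ge_at_top[of 2] by eventually_elim (simp add: w c_def field_simps)
  ultimately show "filterlim (\<lambda>n. w n 1 * (real n * ln (real n) / (s + 1))) at_top sequentially"
    by (rule iffD1[OF filterlim_cong[OF refl refl], rotated])
qed

section \<open>Geometric weights\<close>

text \<open>Each \<open>1 / partial_weight (w n) r\<close> exceeds 1 by at most a multiple of
  \<open>\<theta> ^ r\<close>, so the mean is \<open>n - 1\<close> plus a bounded error.\<close>

lemma necessary_and_sufficient_geometric:
  assumes T: "has_running_time w M T" and \<theta>: "0 < \<theta>" "\<theta> < 1"
    and w: "\<And>n i. n \<ge> 2 \<Longrightarrow> i \<in> {1..n - 1} \<Longrightarrow> w n i = (1 - \<theta>) * \<theta> ^ (i - 1)"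
  shows "necessary_and_sufficient M T (\<lambda>n. real n)"
proof (rule necessary_and_sufficientI[OF T])
  define m where "m n = (\<Sum>r=2..n. 1 / partial_weight (w n) r)" for n
  \<comment> \<open>\<open>C\<close> bounds the total excess: one factor is the coefficient of
    \<open>\<theta> ^ r\<close>, the other the sum of the full geometric series.\<close>
  define C where "C = 1 / (1 - \<theta>) * (1 / (1 - \<theta>))"
  have geo: "(\<Sum>j=1..r. (1 - \<theta>) * \<theta> ^ (j - 1)) = 1 - \<theta> ^ r" for r
    by (induction r) (simp_all add: algebra_simps)
  have "real n - 1 \<le> m n \<and> m n \<le> real n - 1 + C" if n: "n \<ge> 2" for n
  proof
    have wv: "weight_vector n (w n)"
      using T n by (auto simp: has_running_time_def)
    have summand: "1 \<le> 1 / partial_weight (w n) r \<and>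
        1 / partial_weight (w n) r \<le> 1 + 1 / (1 - \<theta>) * \<theta> ^ r" if r: "r \<in> {2..n}" for r
    proof
      show "1 \<le> 1 / partial_weight (w n) r"
        using partial_weight_bounds[OF wv, of r] r by simp
      show "1 / partial_weight (w n) r \<le> 1 + 1 / (1 - \<theta>) * \<theta> ^ r"
      \<comment> \<open>The formula for the weights stops at \<open>n - 1\<close>; the last partial
        weight is 1 by normalisation.\<close>
      proof (cases "r = n")
        case True
        then have "partial_weight (w n) r = 1"
          using wv by (simp add: partial_weight_def weight_vector_def)
        then show ?thesis using \<theta> by simp
      next
        case False
        have "partial_weight (w n) r = (\<Sum>j=1..r. (1 - \<theta>) * \<theta> ^ (j - 1))"
          unfolding partial_weight_def using r False n by (intro sum.cong w) auto
        then have W: "partial_weight (w n) r = 1 - \<theta> ^ r" using geo by simp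
        \<comment> \<open>This makes \<open>1 - \<theta>\<close> a lower bound for the denominators,
          uniformly in \<open>r\<close>.\<close>
        have le: "\<theta> ^ r \<le> \<theta>" using r \<theta> power_decreasing[of 1 r \<theta>] by simp
        have "1 / partial_weight (w n) r = 1 + \<theta> ^ r / (1 - \<theta> ^ r)"
          using le \<theta> by (simp add: W field_simps)
        also have "\<dots> \<le> 1 + \<theta> ^ r / (1 - \<theta>)"
          using le \<theta> by (intro add_mono divide_left_mono) auto
        finally show ?thesis by simp
      qed
    qed
    have "real n - 1 = (\<Sum>r=2..n. 1)" using n by (simp add: of_nat_diff)
    also have "\<dots> \<le> m n" unfolding m_def using summand by (intro sum_mono) auto
    finally show "real n - 1 \<le> m n" .
    have "m n \<le> (\<Sum>r=2..n. 1 + 1 / (1 - \<theta>) * \<theta> ^ r)"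
      unfolding m_def using summand by (intro sum_mono) auto
    also have "\<dots> = real n - 1 + 1 / (1 - \<theta>) * (\<Sum>r=2..n. \<theta> ^ r)"
      using n by (simp add: sum.distrib of_nat_diff flip: sum_distrib_left sum_divide_distrib)
    finally have "m n \<le> real n - 1 + 1 / (1 - \<theta>) * (\<Sum>r=2..n. \<theta> ^ r)" .
    moreover have "(\<Sum>r=2..n. \<theta> ^ r) \<le> 1 / (1 - \<theta>)"
      using \<theta> sum_le_suminf[of "\<lambda>r. \<theta> ^ r" "{2..n}"] by (simp add: suminf_geometric summable_geometric)
    then have "real n - 1 + 1 / (1 - \<theta>) * (\<Sum>r=2..n. \<theta> ^ r) \<le> real n - 1 + C"
      unfolding C_def using \<theta> by (intro add_left_mono mult_left_mono) auto
    ultimately show "m n \<le> real n - 1 + C" by linarith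
  qed
  then have "eventually (\<lambda>n. (real n - 1) / real n \<le> m n / real n) sequentially"
    "eventually (\<lambda>n. m n / real n \<le> (real n - 1 + C) / real n) sequentially"
    by (auto intro!: eventually_sequentiallyI[of 2] divide_right_mono)
  moreover have "(\<lambda>n. (real n - 1) / real n) \<longlonglongrightarrow> 1" "(\<lambda>n. (real n - 1 + C) / real n) \<longlonglongrightarrow> 1"
    by real_asymp+
  ultimately have "(\<lambda>n. m n / real n) \<longlonglongrightarrow> 1"
    by (rule tendsto_sandwich)
  then show "(\<lambda>n. (\<Sum>r=2..n. 1 / partial_weight (w n) r) / real n) \<longlonglongrightarrow> 1"
    by (simp add: m_def)
  \<comment> \<open>For \<open>n \<ge> 2\<close> the index 1 lies in \<open>{1..n - 1}\<close>, so
    the first weight is the constant \<open>1 - \<theta>\<close>.\<close>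
  have "filterlim (\<lambda>n. (1 - \<theta>) * real n) at_top sequentially"
    using \<theta> by real_asymp
  moreover have "eventually (\<lambda>n. (1 - \<theta>) * real n = w n 1 * real n) sequentially"
    using eventually_ge_at_top[of 2] by eventually_elim (simp add: w)
  ultimately show "filterlim (\<lambda>n. w n 1 * real n) at_top sequentially"
    by (rule iffD1[OF filterlim_cong[OF refl refl], rotated])
qed

section \<open>Uniform and Zipf weights\<close>

text \<open>The unnormalised partial sums are \<open>n\<close>, and \<open>ln\<close> is an
  antiderivative of \<open>1 / x\<close>.\<close>

lemma necessary_and_sufficient_uniform:
  assumes T: "has_running_time w M T"
    and w: "\<And>n i. n \<ge> 2 \<Longrightarrow> i \<in> {1..n} \<Longrightarrow> w n i = 1 / real n"
  shows "necessary_and_sufficient M T (\<lambda>n. real n * ln (real n))"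
proof (rule necessary_and_sufficient_scaled_weights[OF T, where v = "\<lambda>_. 1" and g = real and G = "\<lambda>n. ln (real n)"])
  have "(\<lambda>n. 1 / (real n + 1) / (ln (real n + 1) - ln (real n))) \<longlonglongrightarrow> 1"
    by real_asymp
  then show "(\<lambda>n. 1 / real (Suc n) / (ln (real (Suc n)) - ln (real n))) \<longlonglongrightarrow> 1"
    by (simp add: add_ac)
  have "(\<lambda>n. real n / real n) \<longlonglongrightarrow> 1"
    by real_asymp
  then show "(\<lambda>n. (\<Sum>j=1..n. 1) / real n) \<longlonglongrightarrow> 1"
    by simp
qed (use w in simp_all, real_asymp+)

text \<open>Common to the three ranges of \<alpha>: the range enters only through the growth
  \<open>g\<close> of \<open>gen_harm \<alpha>\<close> and the matching \<open>G\<close>.\<close>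

lemma necessary_and_sufficient_zipf:
  assumes T: "has_running_time w M T"
    and w: "\<And>n i. n \<ge> 2 \<Longrightarrow> i \<in> {1..n} \<Longrightarrow> w n i = inverse (real i powr \<alpha> * gen_harm \<alpha> n)"
    and g: "(\<lambda>n. gen_harm \<alpha> n / g n) \<longlonglongrightarrow> 1"
    and "eventually (\<lambda>n. G n < G (Suc n)) sequentially"
    and "filterlim G at_top sequentially"
    and "(\<lambda>n. 1 / g (Suc n) / (G (Suc n) - G n)) \<longlonglongrightarrow> 1"
    and "eventually (\<lambda>n. k n = g n * G n) sequentially"
  shows "necessary_and_sufficient M T k"
proof (rule necessary_and_sufficient_scaled_weights[OF T, where v = "\<lambda>i. real i powr (- \<alpha>)" and g = g and G = G])
  show "w n i = real i powr (- \<alpha>) / (\<Sum>j=1..n. real j powr (- \<alpha>))" if "n \<ge> 2" "i \<in> {1..n}" for n i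
    using w[OF that] by (simp add: gen_harm_def powr_minus divide_inverse)
  show "(\<lambda>n. (\<Sum>j=1..n. real j powr (- \<alpha>)) / g n) \<longlonglongrightarrow> 1"
    using g by (simp add: gen_harm_def)
qed (use assms in simp_all)

text \<open>The antiderivative of \<open>1 / ln x\<close> is the logarithmic integral; its leading
  term \<open>n / ln n\<close> serves as \<open>G\<close>, and multiplying by \<open>g = ln\<close>
  leaves \<open>n\<close>.\<close>

lemma necessary_and_sufficient_zipf_1:
  assumes T: "has_running_time w M T"
    and w: "\<And>n i. n \<ge> 2 \<Longrightarrow> i \<in> {1..n} \<Longrightarrow> w n i = inverse (harm n * real i)"
  shows "necessary_and_sufficient M T (\<lambda>n. real n)"
proof (rule necessary_and_sufficient_zipf[OF T, where \<alpha> = 1 and g = "\<lambda>n. ln (real n)" and G = "\<lambda>n. real n / ln (real n)"])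
  show "(\<lambda>n. gen_harm 1 n / ln (real n)) \<longlonglongrightarrow> 1"
    using harm_asymp by (simp add: gen_harm_1)
  have "eventually (\<lambda>n. real n / ln (real n) < (real n + 1) / ln (real n + 1)) sequentially"
    by real_asymp
  then show "eventually (\<lambda>n. real n / ln (real n) < real (Suc n) / ln (real (Suc n))) sequentially"
    by (simp add: add_ac)
  have "(\<lambda>n. 1 / ln (real n + 1) / ((real n + 1) / ln (real n + 1) - real n / ln (real n))) \<longlonglongrightarrow> 1"
    by real_asymp
  then show "(\<lambda>n. 1 / ln (real (Suc n)) / (real (Suc n) / ln (real (Suc n)) - real n / ln (real n))) \<longlonglongrightarrow> 1"
    by (simp add: add_ac)
  show "eventually (\<lambda>n. real n = ln (real n) * (real n / ln (real n))) sequentially"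
    using eventually_ge_at_top[of 2] by eventually_elim simp
qed (use w in \<open>simp add: gen_harm_1 mult.commute\<close>, real_asymp)

text \<open>\<open>G\<close> is the antiderivative of \<open>1 / g\<close>, that is, of
  \<open>(1 - \<alpha>) * x powr (\<alpha> - 1)\<close>. In \<open>g * G\<close> the powers combine
  to \<open>n\<close> and the constants to \<open>1 / \<alpha>\<close>.\<close>

lemma necessary_and_sufficient_zipf_less_1:
  assumes T: "has_running_time w M T" and \<alpha>: "0 < \<alpha>" "\<alpha> < 1"
    and w: "\<And>n i. n \<ge> 2 \<Longrightarrow> i \<in> {1..n} \<Longrightarrow> w n i = inverse (real i powr \<alpha> * gen_harm \<alpha> n)"
  shows "necessary_and_sufficient M T (\<lambda>n. real n / \<alpha>)"
proof (rule necessary_and_sufficient_zipf[OF T w, where g = "\<lambda>n. real n powr (1 - \<alpha>) / (1 - \<alpha>)"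
      and G = "\<lambda>n. (1 - \<alpha>) / \<alpha> * real n powr \<alpha>"])
  define b where "b = 1 - \<alpha>"
  have b: "0 < b" "b < 1" and \<alpha>b: "\<alpha> = 1 - b" using \<alpha> by (auto simp: b_def)
  show "(\<lambda>n. gen_harm \<alpha> n / (real n powr (1 - \<alpha>) / (1 - \<alpha>))) \<longlonglongrightarrow> 1"
    using \<alpha> by (rule gen_harm_asymp)
  show "eventually (\<lambda>n. (1 - \<alpha>) / \<alpha> * real n powr \<alpha> < (1 - \<alpha>) / \<alpha> * real (Suc n) powr \<alpha>) sequentially"
    using \<alpha> by (intro always_eventually allI mult_strict_left_mono powr_less_mono2) auto
  show "filterlim (\<lambda>n. (1 - \<alpha>) / \<alpha> * real n powr \<alpha>) at_top sequentially"
    unfolding \<alpha>b using b by real_asymp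
  have "(\<lambda>n. 1 / ((real n + 1) powr b / b) /
      (b / (1 - b) * (real n + 1) powr (1 - b) - b / (1 - b) * real n powr (1 - b))) \<longlonglongrightarrow> 1"
    using b by real_asymp
  then show "(\<lambda>n. 1 / (real (Suc n) powr (1 - \<alpha>) / (1 - \<alpha>)) /
      ((1 - \<alpha>) / \<alpha> * real (Suc n) powr \<alpha> - (1 - \<alpha>) / \<alpha> * real n powr \<alpha>)) \<longlonglongrightarrow> 1"
    by (simp add: \<alpha>b add_ac)
  show "eventually (\<lambda>n. real n / \<alpha> =
      real n powr (1 - \<alpha>) / (1 - \<alpha>) * ((1 - \<alpha>) / \<alpha> * real n powr \<alpha>)) sequentially"
    using eventually_gt_at_top[of 0] by eventually_elim (use \<alpha> in \<open>simp flip: powr_add\<close>)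
qed

text \<open>The partial sums converge, so \<open>g\<close> is their constant limit and
  \<open>G\<close> is linear.\<close>

lemma necessary_and_sufficient_zipf_greater_1:
  assumes T: "has_running_time w M T" and \<alpha>: "1 < \<alpha>"
    and w: "\<And>n i. n \<ge> 2 \<Longrightarrow> i \<in> {1..n} \<Longrightarrow> w n i = inverse (real i powr \<alpha> * gen_harm \<alpha> n)"
  shows "necessary_and_sufficient M T (\<lambda>n. real n)"
proof -
  obtain z where z: "z > 0" "(gen_harm \<alpha>) \<longlonglongrightarrow> z"
    using gen_harm_convergent[OF \<alpha>] .
  show ?thesis
  proof (rule necessary_and_sufficient_zipf[OF T w, where g = "\<lambda>_. z" and G = "\<lambda>n. real n / z"])
    show "(\<lambda>n. gen_harm \<alpha> n / z) \<longlonglongrightarrow> 1"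
      using tendsto_divide[OF z(2) tendsto_const[of z]] z(1) by simp
    show "filterlim (\<lambda>n. real n / z) at_top sequentially"
      using z(1) by real_asymp
  qed (use z(1) in \<open>simp_all add: divide_strict_right_mono flip: diff_divide_distrib\<close>)
qed

section \<open>The families of weights combined\<close>

theorem theorem4p3:
  fixes w :: "nat \<Rightarrow> nat \<Rightarrow> real"
    and M :: "nat \<Rightarrow> 'a measure"
    and T :: "nat \<Rightarrow> 'a \<Rightarrow> nat"
  assumes weights: "\<And>n. n \<ge> 2 \<Longrightarrow> weight_vector n (w n)"
    and prob: "\<And>n. n \<ge> 2 \<Longrightarrow> prob_space (M n)"
    and rv: "\<And>n. n \<ge> 2 \<Longrightarrow> T n \<in> measurable (M n) (count_space UNIV)"
    and law: "\<And>n. n \<ge> 2 \<Longrightarrow>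
      distr (M n) (count_space UNIV) (T n) = measure_pmf (running_time_law n (w n))"
  shows
    "((\<forall>n\<ge>2. \<forall>i\<in>{1..n}. w n i = 1 / real n) \<longrightarrow>
        necessary_and_sufficient M T (\<lambda>n. real n * ln (real n))) \<and>
     ((\<forall>n\<ge>2. \<forall>i\<in>{1..n}. w n i = inverse (harm n * real i)) \<longrightarrow>
        necessary_and_sufficient M T (\<lambda>n. real n)) \<and>
     (\<forall>\<alpha>::real. (\<forall>n\<ge>2. \<forall>i\<in>{1..n}. w n i = inverse (real i powr \<alpha> * gen_harm \<alpha> n)) \<longrightarrow>
        (0 < \<alpha> \<and> \<alpha> < 1 \<longrightarrow> necessary_and_sufficient M T (\<lambda>n. real n / \<alpha>)) \<and>
        (1 < \<alpha> \<longrightarrow> necessary_and_sufficient M T (\<lambda>n. real n))) \<and>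
     (\<forall>s::real. 0 < s \<and>
        (\<forall>n\<ge>2. \<forall>i\<in>{1..n}. w n i = (real n - real i + 1) powr s / power_sum n s) \<longrightarrow>
        necessary_and_sufficient M T (\<lambda>n. real n * ln (real n) / (s + 1))) \<and>
     (\<forall>\<theta>::real. 0 < \<theta> \<and> \<theta> < 1 \<and>
        (\<forall>n\<ge>2. (\<forall>i\<in>{1..n - 1}. w n i = (1 - \<theta>) * \<theta> ^ (i - 1)) \<and> w n n = \<theta> ^ (n - 1)) \<longrightarrow>
        necessary_and_sufficient M T (\<lambda>n. real n))"
proof -
  have T: "has_running_time w M T"
    using weights rv law by (simp add: has_running_time_def)
  show ?thesis
  \<comment> \<open>The generalized Zipf law contributes two goals, one for each range of \<alpha>,
    which makes six in all.\<close>
  proof (intro conjI allI impI, goal_cases)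
    case 1
    then show ?case by (intro necessary_and_sufficient_uniform[OF T]) auto
  next
    case 2
    then show ?case by (intro necessary_and_sufficient_zipf_1[OF T]) auto
  next
    case (3 \<alpha>)
    then show ?case by (intro necessary_and_sufficient_zipf_less_1[OF T]) auto
  next
    case (4 \<alpha>)
    then show ?case by (intro necessary_and_sufficient_zipf_greater_1[OF T, of \<alpha>]) auto
  next
    case (5 s)
    then show ?case by (intro necessary_and_sufficient_power_law[OF T]) auto
  next
    case (6 \<theta>)
    then show ?case by (intro necessary_and_sufficient_geometric[OF T, of \<theta>]) auto
  qed
qed

end
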